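(* Let $q=p^n$ with $p$ prime, let $m\ge 1$, and let $r=t(q-1)+s$ with integers $t\ge 0$ and $0\le s\le q-2$, such that $r<m(q-1)$. Let $f\in R_q(r,m)$ be a nonzero codeword of minimal weight, i.e. $|f|=(q-s)q^{m-t-1}$. Then the support $S_f$ is the union of $q-s$ distinct, pairwise parallel affine subspaces of $\mathbb{F}_q^m$ of codimension $t+1$, all contained in a single affine subspace of $\mathbb{F}_q^m$ of codimension $t$. (Conversely, every codeword of $R_q(r,m)$ whose support has this form has minimal weight.)
   Context: $B_m^q=\mathbb{F}_q[X_1,\dots,X_m]/(X_1^q-X_1,\dots,X_m^q-X_m)$ is identified with the algebra of functions $\mathbb{F}_q^m\to\mathbb{F}_q$ via $P\mapsto(x\mapsto P(x))$. For $f\in B_m^q$, $S_f=\{x\in\mathbb{F}_q^m : f(x)\ne 0\}$ is its support and $|f|=\mathrm{Card}(S_f)$ its weight. The degree $\deg(P)$ of $P\in B_m^q$ is the total degree of its unique representative of degree at most $q-1$ in each variable. For $0\le r\le m(q-1)$, the generalized Reed–Muller code is $R_q(r,m)=\{P\in B_m^q : \deg(P)\le r\}$. For $r=t(q-1)+s$ with $0\le s\le q-2$ and $r<m(q-1)$, the minimum weight of a nonzero codeword of $R_q(r,m)$ is $(q-s)q^{m-t-1}$. *)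

theory Defs
  imports "HOL-Analysis.Cartesian_Space"
begin

text \<open>Points of F_q^m are vectors of type 'a^'m, with 'a a finite field (q = CARD('a))
and m = CARD('m). Functions F_q^m -> F_q are the elements of B_m^q.\<close>

definition exps :: "('a::{finite,field}) itself \<Rightarrow> (nat^'m) set" where
  "exps _ = {e. \<forall>i. e $ i \<le> CARD('a) - 1}"

definition eval_red :: "(nat^'m \<Rightarrow> 'a::{finite,field}) \<Rightarrow> 'a^'m \<Rightarrow> 'a" where
  "eval_red c x = (\<Sum>e\<in>exps TYPE('a). c e * (\<Prod>i\<in>UNIV. (x $ i) ^ (e $ i)))"

definition RM :: "nat \<Rightarrow> ('a::{finite,field}^'m \<Rightarrow> 'a) set" where
  "RM r = {f. \<exists>c. (\<forall>e. c e \<noteq> 0 \<longrightarrow> e \<in> exps TYPE('a) \<and> (\<Sum>i\<in>UNIV. e $ i) \<le> r)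
                   \<and> f = eval_red c}"

definition supp :: "('a::{finite,field}^'m \<Rightarrow> 'a) \<Rightarrow> ('a^'m) set" where
  "supp f = {x. f x \<noteq> 0}"

definition weight :: "('a::{finite,field}^'m \<Rightarrow> 'a) \<Rightarrow> nat" where
  "weight f = card (supp f)"

definition affine_with_dir :: "('a::field^'m) set \<Rightarrow> ('a^'m) set \<Rightarrow> bool" where
  "affine_with_dir A V \<longleftrightarrow> vec.subspace V \<and> (\<exists>a. A = (\<lambda>v. a + v) ` V)"

definition affine_codim :: "nat \<Rightarrow> ('a::field^'m) set \<Rightarrow> bool" where
  "affine_codim k A \<longleftrightarrow> k \<le> CARD('m) \<and>
     (\<exists>V. affine_with_dir A V \<and> vec.dim V = CARD('m) - k)"

end

theory Submission
  imports Defs "HOL-Computational_Algebra.Polynomial"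
begin

text \<open>
  Write \<open>q\<close> for the order of the field and let \<open>S\<close> be the support of a word of degree
  \<open>t(q - 1) + s\<close>. If \<open>S\<close> misses \<open>k\<close> hyperplanes of a parallel class, each remaining slice,
  extended to a cylinder transversal to the class, is a word of degree smaller by \<open>k\<close>. Adding up
  the lower bounds for the slices proves the minimum weight bound by induction on the number of
  variables. For a word of minimal weight equality must hold for every parallel class, which forces
  \<open>k \<in> {0, s, q - 1}\<close> and makes all nonempty slices of a class minimal too.

  Not every class has \<open>k = 0\<close>: otherwise all hyperplanes meet \<open>S\<close> equally often, so \<open>S\<close> is the
  whole space. For \<open>t = 0\<close> a class with \<open>k = s\<close> exhibits \<open>S\<close> as a union of \<open>q - s\<close> parallel
  hyperplanes. For \<open>t \<ge> 1\<close> some class has \<open>k = q - 1\<close>, i.e. \<open>S\<close> lies in a hyperplane, and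
  passing to the cylinder over \<open>S\<close> lowers \<open>t\<close> by one. All of this takes place in a fixed ambient
  space, so no induction on its dimension is needed.
\<close>

section \<open>Power sums over a finite field\<close>

lemma card_field_ge_2: "CARD('a::{finite,field}) \<ge> 2"
proof -
  have "card {0, 1::'a} \<le> CARD('a)" by (rule card_mono) auto
  then show ?thesis by simp
qed

text \<open>Multiplication by \<open>x\<close> permutes the nonzero elements, so the factor
  \<open>x ^ (CARD('a) - 1)\<close> leaves their product unchanged.\<close>

lemma power_card_minus_1:
  fixes x :: "'a::{finite,field}"
  assumes "x \<noteq> 0"
  shows "x ^ (CARD('a) - 1) = 1"
proof -
  have "(\<lambda>y. x * y) ` (UNIV - {0}) = UNIV - {0}"
  proof (intro equalityI subsetI)
    fix y :: 'a assume "y \<in> UNIV - {0}"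
    then show "y \<in> (\<lambda>y. x * y) ` (UNIV - {0})"
      using assms by (intro image_eqI[of _ _ "y / x"]) auto
  qed (use assms in auto)
  moreover have "inj_on ((*) x) (UNIV - {0})" using assms by (auto intro: inj_onI)
  ultimately have "\<Prod>(UNIV - {0::'a}) = (\<Prod>y\<in>UNIV - {0}. x * y)"
    by (metis (no_types, lifting) prod.reindex_cong)
  also have "\<dots> = x ^ (CARD('a) - 1) * \<Prod>(UNIV - {0::'a})"
    by (simp add: prod.distrib card_Diff_singleton)
  finally show ?thesis by simp
qed

text \<open>Substituting \<open>g * z\<close> for \<open>z\<close> multiplies the sum by
  \<open>g ^ j\<close>, and some nonzero \<open>g\<close> has \<open>g ^ j \<noteq> 1\<close>
  because \<open>monom 1 j - 1\<close> has at most \<open>j\<close> roots. For \<open>j = 0\<close>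
  every summand is 1, also at \<open>z = 0\<close>, and a translation by 1 is used instead.\<close>

lemma sum_powers_eq_0:
  assumes "j < CARD('a::{finite,field}) - 1"
  shows "(\<Sum>z\<in>(UNIV::'a set). z ^ j) = 0"
proof (cases "j = 0")
  case True
  have "(\<Sum>z\<in>(UNIV::'a set). z) = (\<Sum>z\<in>UNIV. z + 1)"
    by (rule sum.reindex_bij_witness[of _ "\<lambda>z. z + 1" "\<lambda>z. z - 1"]) auto
  then show ?thesis using True by (simp add: sum.distrib)
next
  case False
  define p :: "'a poly" where "p = monom 1 j - 1"
  have deg: "degree p \<le> j" unfolding p_def by (rule degree_diff_le) (auto simp: degree_monom_le)
  have "coeff p j = 1" using False by (simp add: p_def)
  then have "p \<noteq> 0" by auto
  then have "card {x. poly p x = 0} \<le> j"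
    using card_poly_roots_bound deg le_trans by blast
  moreover have "card (UNIV - {0::'a}) = CARD('a) - 1" by (simp add: card_Diff_singleton)
  ultimately have "\<not> UNIV - {0::'a} \<subseteq> {x. poly p x = 0}"
    using assms by (metis card_mono finite linorder_not_less order_trans)
  then obtain g :: 'a where g: "g \<noteq> 0" "g ^ j \<noteq> 1" by (auto simp: p_def poly_monom)
  have "(\<Sum>z\<in>(UNIV::'a set). z ^ j) = (\<Sum>z\<in>UNIV. (g * z) ^ j)"
    by (rule sum.reindex_bij_witness[of _ "\<lambda>z. g * z" "\<lambda>z. z / g"]) (use g in auto)
  also have "\<dots> = g ^ j * (\<Sum>z\<in>UNIV. z ^ j)"
    by (simp add: power_mult_distrib sum_distrib_left)
  finally have "(g ^ j - 1) * (\<Sum>z\<in>(UNIV::'a set). z ^ j) = 0" by (simp add: algebra_simps)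
  then show ?thesis using g by simp
qed

section \<open>Reduced monomials and closure properties of the codes\<close>

definition monomial_fun :: "nat^'m \<Rightarrow> 'a::{finite,field}^'m \<Rightarrow> 'a" where
  "monomial_fun e x = (\<Prod>i\<in>UNIV. (x $ i) ^ (e $ i))"

text \<open>Large exponents are folded into 1, ..., q - 1 and never to 0, since the power has to
  keep vanishing at 0.\<close>

definition reduced_exponent :: "'a::{finite,field} itself \<Rightarrow> nat \<Rightarrow> nat" where
  "reduced_exponent _ n =
     (if n \<le> CARD('a) - 1 then n else (n - 1) mod (CARD('a) - 1) + 1)"

lemma reduced_exponent_le: "reduced_exponent TYPE('a::{finite,field}) n \<le> n"
proof -
  have "(n - 1) mod (CARD('a) - 1) \<le> n - 1" by (rule mod_less_eq_dividend)
  then show ?thesis unfolding reduced_exponent_def by (split if_split) linarith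
qed

lemma reduced_exponent_le_card:
  "reduced_exponent TYPE('a::{finite,field}) n \<le> CARD('a) - 1"
  using card_field_ge_2[where 'a='a]
  by (auto simp: reduced_exponent_def Suc_le_eq)

lemma power_reduced_exponent:
  fixes x :: "'a::{finite,field}"
  shows "x ^ reduced_exponent TYPE('a) n = x ^ n"
proof (cases "n \<le> CARD('a) - 1 \<or> x = 0")
  case True
  then show ?thesis
    using card_field_ge_2[where 'a='a] by (auto simp: reduced_exponent_def)
next
  case False
  have "n = (n - 1) div (CARD('a) - 1) * (CARD('a) - 1) + ((n - 1) mod (CARD('a) - 1) + 1)"
    using False div_mult_mod_eq[of "n - 1" "CARD('a) - 1"] by linarith
  then have "x ^ n = (x ^ (CARD('a) - 1)) ^ ((n - 1) div (CARD('a) - 1))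
      * x ^ ((n - 1) mod (CARD('a) - 1) + 1)"
    by (metis power_add power_mult mult.commute)
  moreover have "x ^ (CARD('a) - 1) = 1" using False by (intro power_card_minus_1) simp
  ultimately show ?thesis using False by (simp add: reduced_exponent_def)
qed

lemma finite_exps: "finite (exps TYPE('a::{finite,field}) :: (nat^'m) set)"
proof (rule finite_imageD)
  show "finite (vec_nth ` (exps TYPE('a) :: (nat^'m) set))"
    by (rule finite_subset[OF _ finite_PiE[of UNIV "\<lambda>_. {..CARD('a) - 1}"]])
      (auto simp: exps_def)
  show "inj_on vec_nth (exps TYPE('a) :: (nat^'m) set)"
    by (simp add: inj_on_def vec_nth_inject)
qed

lemma RM_mono:
  fixes f :: "'a::{finite,field}^'m \<Rightarrow> 'a"
  assumes "f \<in> RM r" "r \<le> r'"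
  shows "f \<in> RM r'"
proof -
  from assms(1) obtain c where "\<forall>e. c e \<noteq> 0 \<longrightarrow> e \<in> exps TYPE('a) \<and> (\<Sum>i\<in>UNIV. e $ i) \<le> r"
    "f = eval_red c"
    unfolding RM_def by blast
  then show ?thesis using assms(2) unfolding RM_def
    by (intro CollectI exI[of _ c]) (auto intro: order_trans)
qed

lemma RM_add:
  fixes f g :: "'a::{finite,field}^'m \<Rightarrow> 'a"
  assumes "f \<in> RM r" "g \<in> RM r"
  shows "(\<lambda>x. f x + g x) \<in> RM r"
proof -
  from assms(1) obtain c where
    c: "\<And>e. c e \<noteq> 0 \<Longrightarrow> e \<in> exps TYPE('a) \<and> (\<Sum>i\<in>UNIV. e $ i) \<le> r" "f = eval_red c"
    unfolding RM_def by blast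
  from assms(2) obtain d where
    d: "\<And>e. d e \<noteq> 0 \<Longrightarrow> e \<in> exps TYPE('a) \<and> (\<Sum>i\<in>UNIV. e $ i) \<le> r" "g = eval_red d"
    unfolding RM_def by blast
  have "(\<lambda>x. f x + g x) = eval_red (\<lambda>e. c e + d e)"
    by (simp add: c(2) d(2) eval_red_def fun_eq_iff sum.distrib distrib_right)
  moreover have "e \<in> exps TYPE('a) \<and> (\<Sum>i\<in>UNIV. e $ i) \<le> r" if "c e + d e \<noteq> 0" for e
    using c(1)[of e] d(1)[of e] that by (cases "c e = 0") auto
  ultimately show ?thesis unfolding RM_def by (intro CollectI exI[of _ "\<lambda>e. c e + d e"]) auto
qed

lemma RM_scale:
  fixes f :: "'a::{finite,field}^'m \<Rightarrow> 'a"
  assumes "f \<in> RM r"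
  shows "(\<lambda>x. k * f x) \<in> RM r"
proof -
  from assms obtain c where
    c: "\<And>e. c e \<noteq> 0 \<Longrightarrow> e \<in> exps TYPE('a) \<and> (\<Sum>i\<in>UNIV. e $ i) \<le> r" "f = eval_red c"
    unfolding RM_def by blast
  have "(\<lambda>x. k * f x) = eval_red (\<lambda>e. k * c e)"
    by (simp add: c(2) eval_red_def fun_eq_iff sum_distrib_left mult.assoc)
  moreover have "e \<in> exps TYPE('a) \<and> (\<Sum>i\<in>UNIV. e $ i) \<le> r" if "k * c e \<noteq> 0" for e
    using c(1)[of e] that by auto
  ultimately show ?thesis unfolding RM_def by (intro CollectI exI[of _ "\<lambda>e. k * c e"]) auto
qed

lemma RM_zero: "(\<lambda>x. 0) \<in> RM r"
  unfolding RM_def by (auto simp: eval_red_def fun_eq_iff intro!: exI[of _ "\<lambda>_. 0"])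

lemma RM_sum: "(\<And>i. i \<in> I \<Longrightarrow> f i \<in> RM r) \<Longrightarrow> (\<lambda>x. \<Sum>i\<in>I. f i x) \<in> RM r"
  by (induction I rule: infinite_finite_induct) (auto simp: RM_zero intro: RM_add)

text \<open>Folding the exponents keeps the function and does not raise the degree. Hence unreduced
  monomials may be used freely, as they arise in products.\<close>

lemma monomial_fun_in_RM: "(monomial_fun e :: 'a::{finite,field}^'m \<Rightarrow> 'a) \<in> RM (\<Sum>i\<in>UNIV. e $ i)"
proof -
  define e' :: "nat^'m" where "e' = (\<chi> i. reduced_exponent TYPE('a) (e $ i))"
  have e': "e' \<in> exps TYPE('a)"
    unfolding exps_def e'_def using reduced_exponent_le_card[where 'a='a] by simp
  have "(\<Sum>i\<in>UNIV. e' $ i) \<le> (\<Sum>i\<in>UNIV. e $ i)"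
    by (rule sum_mono) (simp add: e'_def reduced_exponent_le)
  moreover have "(monomial_fun e :: 'a^'m \<Rightarrow> 'a) = eval_red (\<lambda>d. if d = e' then 1 else 0)"
  proof
    fix x :: "'a^'m"
    have "eval_red (\<lambda>d. if d = e' then 1 else 0) x =
      (\<Sum>d\<in>exps TYPE('a). if d = e' then monomial_fun e' x else 0)"
      unfolding eval_red_def by (rule sum.cong) (auto simp: monomial_fun_def)
    also have "\<dots> = monomial_fun e' x" using e' by (simp add: finite_exps)
    also have "\<dots> = monomial_fun e x"
      by (simp add: monomial_fun_def e'_def power_reduced_exponent)
    finally show "monomial_fun e x = eval_red (\<lambda>d. if d = e' then 1 else 0) x" by simp
  qed
  ultimately show ?thesis unfolding RM_def using e'
    by (intro CollectI exI[of _ "\<lambda>d. if d = e' then 1 else 0"]) auto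
qed

lemma RM_expand:
  fixes f :: "'a::{finite,field}^'m \<Rightarrow> 'a"
  assumes "f \<in> RM r"
  obtains c where "f = (\<lambda>x. \<Sum>e\<in>{e\<in>exps TYPE('a). (\<Sum>i\<in>UNIV. e $ i) \<le> r}.
      c e * monomial_fun e x)"
proof -
  from assms obtain c where
    c: "\<And>e. c e \<noteq> 0 \<Longrightarrow> e \<in> exps TYPE('a) \<and> (\<Sum>i\<in>UNIV. e $ i) \<le> r" "f = eval_red c"
    unfolding RM_def by blast
  have "f = (\<lambda>x. \<Sum>e\<in>{e\<in>exps TYPE('a). (\<Sum>i\<in>UNIV. e $ i) \<le> r}. c e * monomial_fun e x)"
    unfolding c(2) eval_red_def monomial_fun_def
    by (rule ext, rule sum.mono_neutral_right) (use c(1) in \<open>auto simp: finite_exps\<close>)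
  then show ?thesis by (rule that)
qed

lemma RM_mult:
  assumes "f \<in> RM r" "g \<in> RM r'"
  shows "(\<lambda>x :: 'a::{finite,field}^'m. f x * g x) \<in> RM (r + r')"
proof -
  let ?E = "\<lambda>r. {e\<in>exps TYPE('a) :: (nat^'m) set. (\<Sum>i\<in>UNIV. e $ i) \<le> r}"
  obtain c where c: "f = (\<lambda>x. \<Sum>e\<in>?E r. c e * monomial_fun e x)"
    using assms(1) by (rule RM_expand)
  obtain d where d: "g = (\<lambda>x. \<Sum>e\<in>?E r'. d e * monomial_fun e x)"
    using assms(2) by (rule RM_expand)
  have "(\<lambda>x. f x * g x) =
    (\<lambda>x. \<Sum>e\<in>?E r. \<Sum>e'\<in>?E r'. (c e * d e') * monomial_fun (e + e') x)"
    unfolding c d sum_product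
    by (simp add: monomial_fun_def power_add prod.distrib mult_ac)
  also have "\<dots> \<in> RM (r + r')"
  proof (intro RM_sum RM_scale)
    fix e e' assume "e \<in> ?E r" "e' \<in> ?E r'"
    then have "(\<Sum>i\<in>UNIV. (e + e') $ i) \<le> r + r'" by (simp add: sum.distrib)
    then show "monomial_fun (e + e') \<in> RM (r + r')" using monomial_fun_in_RM RM_mono by blast
  qed
  finally show ?thesis .
qed

lemma RM_const: "(\<lambda>x :: 'a::{finite,field}^'m. k) \<in> RM r"
proof -
  have "(\<lambda>x :: 'a^'m. 1) \<in> RM 0"
    using monomial_fun_in_RM[of "0 :: nat^'m", where 'a='a] by (simp add: monomial_fun_def[abs_def])
  from RM_mono[OF RM_scale[OF this, of k], of r] show ?thesis by simp
qed

lemma RM_coordinate: "(\<lambda>x :: 'a::{finite,field}^'m. x $ i) \<in> RM 1"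
proof -
  have "(monomial_fun (axis i 1) :: 'a^'m \<Rightarrow> 'a) = (\<lambda>x. x $ i)"
  proof
    fix x :: "'a^'m"
    have "monomial_fun (axis i 1) x = (\<Prod>j\<in>UNIV. if j = i then x $ i else 1)"
      unfolding monomial_fun_def by (rule prod.cong) (auto simp: axis_def)
    then show "monomial_fun (axis i 1) x = x $ i" by simp
  qed
  moreover have "(\<Sum>j\<in>UNIV. axis i (1::nat) $ j) = 1" by (simp add: axis_def)
  ultimately show ?thesis using monomial_fun_in_RM[of "axis i (1::nat)", where 'a='a] by simp
qed

lemma RM_prod:
  assumes "finite I" "\<And>i. i \<in> I \<Longrightarrow> f i \<in> RM 1"
  shows "(\<lambda>x. \<Prod>i\<in>I. f i x) \<in> RM (card I)"
  using assms
proof (induction I rule: finite_induct)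
  case empty
  then show ?case by (simp add: RM_const)
next
  case (insert i I)
  then show ?case using RM_mult[of "f i" 1 "\<lambda>x. \<Prod>i\<in>I. f i x" "card I"] by simp
qed

section \<open>Joint degree and summation along lines\<close>

text \<open>\<open>joint_degree d F\<close>: as a polynomial in \<open>z\<close> and \<open>x\<close>, \<open>F z x\<close> has total degree at
  most \<open>d\<close>.\<close>

inductive joint_degree :: "nat \<Rightarrow> ('a::{finite,field} \<Rightarrow> 'a^'m \<Rightarrow> 'a) \<Rightarrow> bool" for d where
  monom: "g \<in> RM b \<Longrightarrow> j + b \<le> d \<Longrightarrow> joint_degree d (\<lambda>z x. z ^ j * g x)"
| add: "joint_degree d F \<Longrightarrow> joint_degree d G \<Longrightarrow> joint_degree d (\<lambda>z x. F z x + G z x)"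

lemma joint_degree_mult:
  assumes "joint_degree d F" "joint_degree d' G"
  shows "joint_degree (d + d') (\<lambda>z x. F z x * G z x)"
  using assms(1)
proof induction
  case (monom g b j)
  note g = monom
  from assms(2) show ?case
  proof induction
    case (monom g' b' j')
    have "joint_degree (d + d') (\<lambda>z x. z ^ (j + j') * (g x * g' x))"
      by (rule joint_degree.monom[OF RM_mult[OF g(1) monom(1)]]) (use g monom in simp)
    then show ?case by (simp add: power_add mult_ac)
  next
    case (add F G)
    then show ?case using joint_degree.add[OF add.IH] by (simp add: distrib_left)
  qed
next
  case (add F1 F2)
  then show ?case using joint_degree.add[OF add.IH] by (simp add: distrib_right)
qed

lemma joint_degree_mono: "joint_degree d F \<Longrightarrow> d \<le> d' \<Longrightarrow> joint_degree d' F"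
  by (induction rule: joint_degree.induct) (auto intro: joint_degree.intros)

lemma joint_degree_const: "joint_degree d (\<lambda>z x. k)"
  using joint_degree.monom[of "\<lambda>x. k" 0 0 d] by (simp add: RM_const)

lemma joint_degree_sum:
  "(\<And>i. i \<in> I \<Longrightarrow> joint_degree d (F i)) \<Longrightarrow> joint_degree d (\<lambda>z x. \<Sum>i\<in>I. F i z x)"
  by (induction I rule: infinite_finite_induct)
    (auto simp: joint_degree_const intro: joint_degree.add)

lemma joint_degree_power:
  "joint_degree d F \<Longrightarrow> joint_degree (n * d) (\<lambda>z x. F z x ^ n)"
  by (induction n) (auto simp: joint_degree_const intro: joint_degree_mult)

lemma joint_degree_prod:
  "(\<And>i. i \<in> I \<Longrightarrow> joint_degree (d i) (F i)) \<Longrightarrow>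
    joint_degree (\<Sum>i\<in>I. d i) (\<lambda>z x. \<Prod>i\<in>I. F i z x)"
  by (induction I rule: infinite_finite_induct)
    (auto simp: joint_degree_const intro: joint_degree_mult)

text \<open>Each coordinate of \<open>x + z *s u\<close> is jointly linear in \<open>z\<close> and
  \<open>x\<close>, so substitution does not raise the degree of a monomial.\<close>

lemma joint_degree_translate:
  fixes f :: "'a::{finite,field}^'m \<Rightarrow> 'a"
  assumes "f \<in> RM r"
  shows "joint_degree r (\<lambda>z x. f (x + z *s u))"
proof -
  let ?E = "{e\<in>exps TYPE('a) :: (nat^'m) set. (\<Sum>i\<in>UNIV. e $ i) \<le> r}"
  obtain c where c: "f = (\<lambda>x. \<Sum>e\<in>?E. c e * monomial_fun e x)"
    using assms by (rule RM_expand)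
  have lin: "joint_degree 1 (\<lambda>z x. (x + z *s u) $ i)" for i
    using joint_degree.add[OF joint_degree.monom[OF RM_coordinate[of i], of 0 1]
        joint_degree.monom[OF RM_const[of "u $ i" 0], of 1 1]] by simp
  have "joint_degree r (\<lambda>z x. c e * monomial_fun e (x + z *s u))" if "e \<in> ?E" for e
  proof -
    have "joint_degree (\<Sum>i\<in>UNIV. e $ i * 1) (\<lambda>z x. monomial_fun e (x + z *s u))"
      unfolding monomial_fun_def by (intro joint_degree_prod joint_degree_power lin)
    from joint_degree_mult[OF joint_degree_const[of 0 "c e"] this] that show ?thesis
      by (auto intro: joint_degree_mono)
  qed
  then show ?thesis unfolding c by (rule joint_degree_sum)
qed

text \<open>Only powers of \<open>z\<close> with exponent at least q - 1 survive the sum, which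
  leaves that much less degree for \<open>x\<close>. The second conjunct covers small
  \<open>d\<close>, where truncated subtraction gives degree 0 and would still permit nonzero
  constants.\<close>

lemma joint_degree_sum_over_field:
  assumes "joint_degree d (F :: 'a::{finite,field} \<Rightarrow> 'a^'m \<Rightarrow> 'a)"
  shows "(\<lambda>x. \<Sum>z\<in>UNIV. F z x) \<in> RM (d - (CARD('a) - 1)) \<and>
    (d < CARD('a) - 1 \<longrightarrow> (\<lambda>x. \<Sum>z\<in>UNIV. F z x) = (\<lambda>x. 0))"
  using assms
proof induction
  case (monom g b j)
  have eq: "(\<lambda>x. \<Sum>z\<in>UNIV. z ^ j * g x) = (\<lambda>x. (\<Sum>z\<in>UNIV. z ^ j) * g x)"
    by (simp add: sum_distrib_right)
  show ?case
  proof (cases "j < CARD('a) - 1")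
    case True
    then show ?thesis by (simp add: eq sum_powers_eq_0 RM_zero)
  next
    case False
    then show ?thesis unfolding eq using monom
      by (auto intro!: RM_scale intro: RM_mono)
  qed
next
  case (add F G)
  then show ?case by (auto simp: sum.distrib fun_eq_iff intro: RM_add)
qed


section \<open>Parallel hyperplanes, slices and cylinders\<close>

abbreviation dot :: "'a::{finite,field}^'m \<Rightarrow> 'a^'m \<Rightarrow> 'a" where
  "dot \<equiv> scalar_product"

lemma dot_simps [simp]:
  fixes a b x y :: "'a::{finite,field}^'m"
  shows "dot a (x + y) = dot a x + dot a y"
    and "dot a (x - y) = dot a x - dot a y"
    and "dot a (z *s x) = z * dot a x"
    and "dot a 0 = 0" and "dot 0 a = 0"
    and "dot (a + b) x = dot a x + dot b x"
    and "dot (a - b) x = dot a x - dot b x"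
    and "dot (z *s a) x = z * dot a x"
    and "dot (axis i 1) x = x $ i"
    and "dot a (axis i 1) = a $ i"
  by (simp_all add: scalar_product_def algebra_simps sum.distrib sum_subtractf sum_distrib_left
      axis_def if_distrib[of "\<lambda>c. c * _"] if_distrib[of "\<lambda>c. _ * c"] cong: if_cong)

lemma dot_commute: "dot a x = dot x a"
  by (simp add: scalar_product_def mult.commute)

lemma ex_dot_eq_1:
  assumes "a \<noteq> 0"
  obtains u where "dot a u = 1"
proof -
  from assms obtain i where "a $ i \<noteq> 0" by (auto simp: vec_eq_iff)
  then have "dot a ((1 / a $ i) *s axis i 1) = 1" by simp
  then show thesis by (rule that)
qed

definition hyperplane :: "'a::{finite,field}^'m \<Rightarrow> 'a \<Rightarrow> ('a^'m) set" where
  "hyperplane a w = {x. dot a x = w}"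

definition missed :: "('a::{finite,field}^'m \<Rightarrow> 'a) \<Rightarrow> 'a^'m \<Rightarrow> 'a set" where
  "missed f a = {w. supp f \<inter> hyperplane a w = {}}"

text \<open>\<open>cylinder f a u w\<close> is the restriction of \<open>f\<close> to \<open>hyperplane a w\<close>, extended constantly along
  \<open>u\<close>; this needs \<open>dot a u = 1\<close>.\<close>

definition cylinder ::
  "('a::{finite,field}^'m \<Rightarrow> 'a) \<Rightarrow> 'a^'m \<Rightarrow> 'a^'m \<Rightarrow> 'a \<Rightarrow> 'a^'m \<Rightarrow> 'a" where
  "cylinder f a u w x = f (x + (w - dot a x) *s u)"

lemma cylinder_eq_on_hyperplane: "x \<in> hyperplane a w \<Longrightarrow> cylinder f a u w x = f x"
  by (simp add: hyperplane_def cylinder_def)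

lemma cylinder_translate: "dot a u = 1 \<Longrightarrow> cylinder f a u w (x + z *s u) = cylinder f a u w x"
  by (simp add: cylinder_def vec.scale_left_distrib vec.scale_left_diff_distrib algebra_simps)

lemma supp_cylinder_translate:
  "dot a u = 1 \<Longrightarrow> x \<in> supp (cylinder f a u w) \<Longrightarrow> x + z *s u \<in> supp (cylinder f a u w)"
  by (simp add: supp_def cylinder_translate)

lemma card_missed_less: "f \<noteq> (\<lambda>x. 0) \<Longrightarrow> card (missed (f :: 'a::{finite,field}^'m \<Rightarrow> 'a) a) < CARD('a)"
proof -
  assume "f \<noteq> (\<lambda>x. 0)"
  then obtain x where "f x \<noteq> 0" by auto
  then have "dot a x \<notin> missed f a" by (auto simp: missed_def supp_def hyperplane_def)
  then show ?thesis by (intro psubset_card_mono) auto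
qed

lemma cylinder_nonzero:
  assumes "w \<notin> missed f a"
  shows "cylinder f a u w \<noteq> (\<lambda>x. 0)"
proof -
  from assms obtain x where "f x \<noteq> 0" "x \<in> hyperplane a w" by (auto simp: missed_def supp_def)
  then show ?thesis by (metis cylinder_eq_on_hyperplane)
qed

text \<open>Multiplying by the linear factors of the remaining parallel hyperplanes isolates the slice
  at \<open>w\<close> at the cost of \<open>q - 1 - k\<close> degrees; summing over the lines in direction \<open>u\<close>
  then gains \<open>q - 1\<close> degrees and spreads the slice to a cylinder.\<close>

lemma cylinder_in_RM:
  fixes f :: "'a::{finite,field}^'m \<Rightarrow> 'a"
  assumes f: "f \<in> RM r" and u: "dot a u = 1" and w: "w \<notin> missed f a"
  shows "card (missed f a) \<le> r" and "cylinder f a u w \<in> RM (r - card (missed f a))"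
proof -
  define R where "R = - insert w (missed f a)"
  define h where "h = (\<lambda>x. f x * (\<Prod>v\<in>R. dot a x - v))"
  define K where "K = (\<Prod>v\<in>R. w - v)"
  have "K \<noteq> 0" by (auto simp: K_def R_def)
  have cR: "card R + card (missed f a) = CARD('a) - 1" "card (missed f a) < CARD('a)"
  proof -
    have "card R = CARD('a) - card (insert w (missed f a))" unfolding R_def
      by (simp add: Compl_eq_Diff_UNIV card_Diff_subset)
    moreover have "card (insert w (missed f a)) \<le> CARD('a)" by (rule card_mono) auto
    ultimately show "card R + card (missed f a) = CARD('a) - 1" "card (missed f a) < CARD('a)"
      using w by auto
  qed
  have "(\<lambda>x. dot a x) \<in> RM 1"
    unfolding scalar_product_def by (intro RM_sum RM_scale RM_coordinate)
  from RM_add[OF this RM_const[of "- v" for v]] have "(\<lambda>x. dot a x - v) \<in> RM 1" for v by simp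
  then have "h \<in> RM (r + card R)" unfolding h_def by (intro RM_mult f RM_prod) auto
  from joint_degree_sum_over_field[OF joint_degree_translate[OF this, of u]]
  have T: "(\<lambda>x. \<Sum>z\<in>UNIV. h (x + z *s u)) \<in> RM (r + card R - (CARD('a) - 1))"
    "r + card R < CARD('a) - 1 \<Longrightarrow> (\<lambda>x. \<Sum>z\<in>UNIV. h (x + z *s u)) = (\<lambda>x. 0)" by auto
  have h0: "h x = 0" if "dot a x \<noteq> w" for x
  proof (cases "dot a x \<in> missed f a")
    case True
    then show ?thesis by (auto simp: h_def missed_def supp_def hyperplane_def)
  next
    case False
    then have "dot a x \<in> R" using that by (simp add: R_def)
    then have "(\<Prod>v\<in>R. dot a x - v) = 0" by (intro prod_zero) auto
    then show ?thesis by (simp add: h_def)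
  qed
  have eq: "(\<lambda>x. \<Sum>z\<in>UNIV. h (x + z *s u)) = (\<lambda>x. K * cylinder f a u w x)"
  proof
    fix x
    \<comment> \<open>The line through \<open>x\<close> in direction \<open>u\<close> meets the
      hyperplane at \<open>w\<close> only for this parameter.\<close>
    have "(\<Sum>z\<in>UNIV. h (x + z *s u)) = (\<Sum>z\<in>{w - dot a x}. h (x + z *s u))"
      by (rule sum.mono_neutral_right) (auto intro!: h0 simp: u)
    also have "\<dots> = K * cylinder f a u w x" by (simp add: h_def u K_def cylinder_def)
    finally show "(\<Sum>z\<in>UNIV. h (x + z *s u)) = K * cylinder f a u w x" .
  qed
  show le: "card (missed f a) \<le> r"
  proof (rule ccontr)
    assume "\<not> ?thesis"
    \<comment> \<open>If more than \<open>r\<close> hyperplanes were missed, \<open>h\<close> would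
      have degree below q - 1 and its sums along lines would vanish.\<close>
    then have "(\<lambda>x. K * cylinder f a u w x) = (\<lambda>x. 0)" using T(2) cR eq by simp
    then show False using cylinder_nonzero[OF w, of u] \<open>K \<noteq> 0\<close> by (auto simp: fun_eq_iff)
  qed
  have "r + card R - (CARD('a) - 1) = r - card (missed f a)" using le cR by linarith
  then have "(\<lambda>x. K * cylinder f a u w x) \<in> RM (r - card (missed f a))" using T(1) eq by simp
  from RM_scale[OF this, of "inverse K"] \<open>K \<noteq> 0\<close>
  show "cylinder f a u w \<in> RM (r - card (missed f a))"
    by (simp add: mult.assoc[symmetric])
qed

text \<open>A point of the cylinder is determined by the value of the form there and by the unique
  point where its line in direction \<open>u\<close> meets the slice.\<close>

lemma weight_cylinder:
  fixes f :: "'a::{finite,field}^'m \<Rightarrow> 'a"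
  assumes u: "dot a u = 1"
  shows "weight (cylinder f a u w) = CARD('a) * card (supp f \<inter> hyperplane a w)"
proof -
  have "bij_betw (\<lambda>x. (dot a x, x + (w - dot a x) *s u)) (supp (cylinder f a u w))
      (UNIV \<times> (supp f \<inter> hyperplane a w))"
    by (rule bij_betw_byWitness[where f' = "\<lambda>(z, y). y + (z - w) *s u"])
      (auto simp: u supp_def hyperplane_def cylinder_def vec.scale_left_diff_distrib)
  then show ?thesis unfolding weight_def
    by (simp add: bij_betw_same_card card_cartesian_product)
qed

lemma card_eq_sum_hyperplanes:
  fixes S :: "('a::{finite,field}^'m) set"
  shows "card S = (\<Sum>w\<in>UNIV. card (S \<inter> hyperplane a w))"
proof -
  have "S = (\<Union>w\<in>UNIV. S \<inter> hyperplane a w)" by (auto simp: hyperplane_def)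
  also have "card \<dots> = (\<Sum>w\<in>UNIV. card (S \<inter> hyperplane a w))"
    by (rule card_UN_disjoint) (auto simp: hyperplane_def)
  finally show ?thesis .
qed

lemma weight_eq_sum_cylinders:
  fixes f :: "'a::{finite,field}^'m \<Rightarrow> 'a"
  assumes u: "dot a u = 1"
  shows "CARD('a) * weight f = (\<Sum>w\<in>- missed f a. weight (cylinder f a u w))"
proof -
  have "weight f = (\<Sum>w\<in>UNIV. card (supp f \<inter> hyperplane a w))"
    unfolding weight_def by (rule card_eq_sum_hyperplanes)
  also have "\<dots> = (\<Sum>w\<in>- missed f a. card (supp f \<inter> hyperplane a w))"
    by (rule sum.mono_neutral_right) (auto simp: missed_def)
  finally show ?thesis by (simp add: weight_cylinder[OF u] sum_distrib_left)
qed

section \<open>The minimum weight bound\<close>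

text \<open>\<open>t'\<close> and \<open>s'\<close> are quotient and remainder of the lowered degree
  modulo q - 1. The inequality compares the bound for a word with the sum of the bounds for its q -
  k slices, cleared of denominators. The gap is \<open>k * (s - k) * q ^ t\<close> if
  \<open>k \<le> s\<close> and \<open>(k - s) * (q - k - 1) * q ^ t\<close> otherwise, whose zeros
  are the listed cases.\<close>

lemma degree_drop_arith:
  fixes q s t k :: nat
  assumes q: "q \<ge> 2" and s: "s \<le> q - 2" and k: "k < q" "k \<le> t * (q - 1) + s"
  defines "t' \<equiv> if k \<le> s then t else t - 1"
    and "s' \<equiv> if k \<le> s then s - k else q - 1 + s - k"
  shows "s' \<le> q - 2" "t * (q - 1) + s - k = t' * (q - 1) + s'"
    and "q * (q - s) * q ^ t' \<le> (q - k) * (q - s') * q ^ t"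
    and "q * (q - s) * q ^ t' = (q - k) * (q - s') * q ^ t \<Longrightarrow>
      k = 0 \<or> k = s \<or> k = q - 1 \<and> s < k \<and> t \<ge> 1"
proof -
  have "s' \<le> q - 2 \<and> t * (q - 1) + s - k = t' * (q - 1) + s' \<and>
    q * (q - s) * q ^ t' \<le> (q - k) * (q - s') * q ^ t \<and>
    (q * (q - s) * q ^ t' = (q - k) * (q - s') * q ^ t \<longrightarrow>
      k = 0 \<or> k = s \<or> k = q - 1 \<and> s < k \<and> t \<ge> 1)"
  proof (cases "k \<le> s")
    case True
    define c where "c = q - s"
    have c: "q = k + (s - k) + c" "q - s = c" "q - k = (s - k) + c" "q - (s - k) = k + c"
      using True s q by (auto simp: c_def)
    have "(q - k) * (q - (s - k)) = q * (q - s) + k * (s - k)"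
      by (subst c(1), subst c(2), subst c(3), subst c(4)) (simp add: algebra_simps)
    then have "(q - k) * (q - (s - k)) * q ^ t = q * (q - s) * q ^ t + k * (s - k) * q ^ t"
      by (simp add: distrib_right)
    then show ?thesis using True s q unfolding t'_def s'_def by auto
  next
    case False
    define b d where "b = k - s" "d = q - k"
    have t: "t \<ge> 1" using False k by (cases t) auto
    then obtain t0 where t0: "t = Suc t0" by (cases t) auto
    have e: "q - s = b + d" "q - (q - 1 + s - k) = b + 1" "b \<ge> 1" "d \<ge> 1"
      using False k s q by (auto simp: b_d_def)
    have "d * (b + 1) = (b + d) + b * (d - 1)" using e by (cases d) auto
    then have "(q - k) * (b + 1) * q ^ t = (b + d + b * (d - 1)) * q ^ t"
      by (simp only: b_d_def(2)[symmetric])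
    also have "\<dots> = q * (b + d) * q ^ t0 + b * (d - 1) * q ^ t"
      by (simp only: t0 power_Suc distrib_right distrib_left mult_ac)
    finally have "(q - k) * (b + 1) * q ^ t = q * (b + d) * q ^ t0 + b * (d - 1) * q ^ t" .
    then have eq: "(q - k) * (q - s') * q ^ t = q * (q - s) * q ^ t' + b * (d - 1) * q ^ t"
      using False e by (simp add: t'_def s'_def t0)
    have "k = q - 1" if "q * (q - s) * q ^ t' = (q - k) * (q - s') * q ^ t"
    proof -
      have "b * (d - 1) * q ^ t = 0" using that eq by linarith
      then have "d - 1 = 0" using e q by simp
      then show ?thesis using e k by (simp add: b_d_def)
    qed
    moreover have "q * (q - s) * q ^ t' \<le> (q - k) * (q - s') * q ^ t" unfolding eq by (rule le_add1)
    moreover have "t * (q - 1) + s - k = t' * (q - 1) + s'"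
      using False k q by (simp add: t'_def s'_def t0)
    moreover have "s' \<le> q - 2" using False q by (simp add: s'_def)
    moreover have "s < k" using False by simp
    ultimately show ?thesis using t by blast
  qed
  then show "s' \<le> q - 2" "t * (q - 1) + s - k = t' * (q - 1) + s'"
    "q * (q - s) * q ^ t' \<le> (q - k) * (q - s') * q ^ t"
    "q * (q - s) * q ^ t' = (q - k) * (q - s') * q ^ t \<Longrightarrow>
      k = 0 \<or> k = s \<or> k = q - 1 \<and> s < k \<and> t \<ge> 1"
    by auto
qed

lemma sum_weights_ge:
  fixes g :: "'b \<Rightarrow> nat"
  assumes "finite I" "\<And>i. i \<in> I \<Longrightarrow> M \<le> g i * c"
  shows "card I * M \<le> (\<Sum>i\<in>I. g i) * c"
  using sum_bounded_below[of I M "\<lambda>i. g i * c"] assms by (simp add: sum_distrib_right)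

text \<open>The induction step: each of the q - k nonempty slices obeys the bound for the lowered
  degree, and their cylinders add up to q times the weight.\<close>

lemma weight_bound_of_cylinders:
  fixes f :: "'a::{finite,field}^'m \<Rightarrow> 'a"
  assumes f: "f \<in> RM (t * (CARD('a) - 1) + s)" "f \<noteq> (\<lambda>x. 0)" and s: "s \<le> CARD('a) - 2"
    and u: "dot a u = 1"
    and bound: "\<And>w t' s'. w \<notin> missed f a \<Longrightarrow> s' \<le> CARD('a) - 2 \<Longrightarrow>
      cylinder f a u w \<in> RM (t' * (CARD('a) - 1) + s') \<Longrightarrow>
      (CARD('a) - s') * CARD('a) ^ CARD('m) \<le> weight (cylinder f a u w) * CARD('a) ^ (t' + 1)"
  shows "(CARD('a) - s) * CARD('a) ^ CARD('m) \<le> weight f * CARD('a) ^ (t + 1)"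
proof -
  let ?q = "CARD('a)" and ?n = "CARD('m)"
  define k where "k = card (missed f a)"
  have kq: "k < ?q" using card_missed_less[OF f(2)] by (simp add: k_def)
  then obtain w where w: "w \<notin> missed f a" unfolding k_def by (metis UNIV_eq_I less_irrefl)
  have kr: "k \<le> t * (?q - 1) + s" using cylinder_in_RM(1)[OF f(1) u w] by (simp add: k_def)
  define t' s' where "t' = (if k \<le> s then t else t - 1)"
    and "s' = (if k \<le> s then s - k else ?q - 1 + s - k)"
  note ar = degree_drop_arith[OF card_field_ge_2 s kq kr, folded t'_def s'_def]
  have "card (- missed f a) * ((?q - s') * ?q ^ ?n)
      \<le> (\<Sum>w\<in>- missed f a. weight (cylinder f a u w)) * ?q ^ (t' + 1)"
    using cylinder_in_RM(2)[OF f(1) u] ar(1,2)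
    by (intro sum_weights_ge bound) (auto simp: k_def)
  moreover have "card (- missed f a) = ?q - k"
    by (simp add: Compl_eq_Diff_UNIV card_Diff_subset k_def)
  ultimately have "(?q - k) * ((?q - s') * ?q ^ ?n) \<le> (?q * weight f) * ?q ^ (t' + 1)"
    by (simp only: weight_eq_sum_cylinders[OF u])
  then have "(?q - k) * ((?q - s') * ?q ^ ?n) * ?q ^ t \<le> (?q * weight f) * ?q ^ (t' + 1) * ?q ^ t"
    by (rule mult_le_mono1)
  moreover have "q * (q - s) * q ^ t' * ?q ^ ?n \<le> (q - k) * (q - s') * q ^ t * ?q ^ ?n"
    if "q = ?q" for q
    unfolding that by (rule mult_le_mono1) (rule ar(3))
  ultimately have "(?q * ?q ^ t') * ((?q - s) * ?q ^ ?n) \<le> (?q * ?q ^ t') * (weight f * ?q ^ (t + 1))"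
    by (fastforce simp: algebra_simps)
  then show ?thesis by simp
qed

text \<open>The induction shrinks a set \<open>J\<close> of coordinates that determine
  \<open>f\<close>, in place of the dimension: a cylinder along an axis no longer depends on that
  coordinate.\<close>

lemma weight_bound_dependent:
  fixes f :: "'a::{finite,field}^'m \<Rightarrow> 'a"
  assumes "finite J" "\<And>x y. (\<And>i. i \<in> J \<Longrightarrow> x $ i = y $ i) \<Longrightarrow> f x = f y"
    and "f \<in> RM (t * (CARD('a) - 1) + s)" "f \<noteq> (\<lambda>x. 0)" "s \<le> CARD('a) - 2"
  shows "(CARD('a) - s) * CARD('a) ^ CARD('m) \<le> weight f * CARD('a) ^ (t + 1)"
  using assms
proof (induction J arbitrary: f t s rule: finite_induct)
  case empty
  from empty.prems(3) obtain x where "f x \<noteq> 0" by auto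
  moreover have "f y = f x" for y by (rule empty.prems(1)) simp
  ultimately have "supp f = UNIV" unfolding supp_def by (metis (mono_tags) UNIV_eq_I mem_Collect_eq)
  then have "weight f = CARD('a) ^ CARD('m)" by (simp add: weight_def)
  moreover have "CARD('a) - s \<le> CARD('a) * CARD('a) ^ t" by (rule le_trans[of _ "CARD('a)"]) auto
  ultimately show ?case by simp
next
  case (insert i J)
  \<comment> \<open>Used both as form and as direction, so that the cylinder overwrites coordinate
    \<open>i\<close> by \<open>w\<close>.\<close>
  let ?a = "axis i 1 :: 'a^'m"
  have u: "dot ?a ?a = 1" by simp
  show ?case
  proof (rule weight_bound_of_cylinders[OF insert.prems(2-4) u])
    fix w t' s'
    assume w: "w \<notin> missed f ?a" and s': "s' \<le> CARD('a) - 2"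
      and RM: "cylinder f ?a ?a w \<in> RM (t' * (CARD('a) - 1) + s')"
    show "(CARD('a) - s') * CARD('a) ^ CARD('m) \<le> weight (cylinder f ?a ?a w) * CARD('a) ^ (t' + 1)"
    proof (rule insert.IH[OF _ RM cylinder_nonzero[OF w] s'])
      fix x y :: "'a^'m"
      assume xy: "\<And>i. i \<in> J \<Longrightarrow> x $ i = y $ i"
      show "cylinder f ?a ?a w x = cylinder f ?a ?a w y"
        unfolding cylinder_def dot_simps by (rule insert.prems(1)) (use xy in \<open>auto simp: axis_def\<close>)
    qed
  qed
qed

lemma weight_bound:
  fixes f :: "'a::{finite,field}^'m \<Rightarrow> 'a"
  assumes "f \<in> RM (t * (CARD('a) - 1) + s)" "f \<noteq> (\<lambda>x. 0)" "s \<le> CARD('a) - 2"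
  shows "(CARD('a) - s) * CARD('a) ^ CARD('m) \<le> weight f * CARD('a) ^ (t + 1)"
  by (rule weight_bound_dependent[of UNIV, OF _ _ assms]) (auto simp: vec_eq_iff intro: arg_cong[of _ _ f])

section \<open>Words attaining the bound\<close>

text \<open>The weight condition is multiplied by \<open>q ^ (t + 1)\<close> to avoid truncated exponents.\<close>

definition minimal_word :: "nat \<Rightarrow> nat \<Rightarrow> ('a::{finite,field}^'m \<Rightarrow> 'a) \<Rightarrow> bool" where
  "minimal_word t s f \<longleftrightarrow> s \<le> CARD('a) - 2 \<and> f \<in> RM (t * (CARD('a) - 1) + s) \<and>
     weight f * CARD('a) ^ (t + 1) = (CARD('a) - s) * CARD('a) ^ CARD('m)"

lemma minimal_word_nonzero:
  fixes f :: "'a::{finite,field}^'m \<Rightarrow> 'a"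
  assumes "minimal_word t s f"
  shows "f \<noteq> (\<lambda>x. 0)"
proof
  assume "f = (\<lambda>x. 0)"
  then have "weight f = 0" by (simp add: weight_def supp_def)
  then show False using assms card_field_ge_2[where 'a='a] by (auto simp: minimal_word_def)
qed

lemma sum_weights_eq:
  fixes g :: "'b \<Rightarrow> nat"
  assumes "finite I" "\<And>i. i \<in> I \<Longrightarrow> M \<le> g i * c" "(\<Sum>i\<in>I. g i) * c \<le> card I * M" "j \<in> I"
  shows "g j * c = M"
proof (rule ccontr)
  assume "g j * c \<noteq> M"
  then have "M < g j * c" using assms(2)[OF assms(4)] by simp
  then have "(\<Sum>i\<in>I. M) < (\<Sum>i\<in>I. g i * c)"
    using assms by (intro sum_strict_mono_ex1) auto
  then show False using assms(3) by (simp add: sum_distrib_right)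
qed

text \<open>Minimality leaves no slack in the summed estimate, so the gap in
  \<open>degree_drop_arith\<close> is zero and every nonempty slice attains its own bound. The three
  solutions give \<open>(t', s')\<close> as \<open>(t, s)\<close>, \<open>(t, 0)\<close> and
  \<open>(t - 1, s)\<close>.\<close>

lemma minimal_word_cylinders:
  fixes f :: "'a::{finite,field}^'m \<Rightarrow> 'a"
  assumes f: "minimal_word t s f" and u: "dot a u = 1"
  defines "k \<equiv> card (missed f a)"
  shows "k = 0 \<and> (\<forall>w. minimal_word t s (cylinder f a u w)) \<or>
    k = s \<and> (\<forall>w. w \<notin> missed f a \<longrightarrow> minimal_word t 0 (cylinder f a u w)) \<or>
    k = CARD('a) - 1 \<and> t \<ge> 1 \<and>
      (\<forall>w. w \<notin> missed f a \<longrightarrow> minimal_word (t - 1) s (cylinder f a u w))"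
proof -
  let ?q = "CARD('a)" and ?n = "CARD('m)"
  note f0 = minimal_word_nonzero[OF f]
  from f have s: "s \<le> ?q - 2" and fR: "f \<in> RM (t * (?q - 1) + s)"
    and wf: "weight f * ?q ^ (t + 1) = (?q - s) * ?q ^ ?n" by (auto simp: minimal_word_def)
  have kq: "k < ?q" using card_missed_less[OF f0] by (simp add: k_def)
  then obtain w where w: "w \<notin> missed f a" unfolding k_def by (metis UNIV_eq_I less_irrefl)
  have kr: "k \<le> t * (?q - 1) + s" using cylinder_in_RM(1)[OF fR u w] by (simp add: k_def)
  define t' s' where "t' = (if k \<le> s then t else t - 1)"
    and "s' = (if k \<le> s then s - k else ?q - 1 + s - k)"
  note ar = degree_drop_arith[OF card_field_ge_2 s kq kr, folded t'_def s'_def]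
  have cR: "cylinder f a u w \<in> RM (t' * (?q - 1) + s')" if "w \<notin> missed f a" for w
    using cylinder_in_RM(2)[OF fR u that] ar(2) by (simp add: k_def)
  have cb: "(?q - s') * ?q ^ ?n \<le> weight (cylinder f a u w) * ?q ^ (t' + 1)"
    if "w \<notin> missed f a" for w
    by (rule weight_bound[OF cR[OF that] cylinder_nonzero[OF that] ar(1)])
  have card: "card (- missed f a) = ?q - k"
    by (simp add: Compl_eq_Diff_UNIV card_Diff_subset k_def)
  have "card (- missed f a) * ((?q - s') * ?q ^ ?n)
      \<le> (\<Sum>w\<in>- missed f a. weight (cylinder f a u w)) * ?q ^ (t' + 1)"
    by (intro sum_weights_ge cb) auto
  then have 1: "(?q - k) * ((?q - s') * ?q ^ ?n) \<le> (?q * weight f) * ?q ^ (t' + 1)"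
    by (simp only: weight_eq_sum_cylinders[OF u] card)
  have 2: "(?q * weight f) * ?q ^ (t' + 1) * ?q ^ t = (?q * (?q - s) * ?q ^ t') * ?q ^ ?n"
  proof -
    have "(?q * weight f) * ?q ^ (t' + 1) * ?q ^ t = (?q * ?q ^ t') * (weight f * ?q ^ (t + 1))"
      by (simp add: mult_ac)
    also have "\<dots> = (?q * (?q - s) * ?q ^ t') * ?q ^ ?n"
      unfolding wf by (simp add: mult_ac)
    finally show ?thesis .
  qed
  have 3: "(?q - k) * ((?q - s') * ?q ^ ?n) * ?q ^ t = ((?q - k) * (?q - s') * ?q ^ t) * ?q ^ ?n"
    by (simp add: mult_ac)
  \<comment> \<open>Inserting the weight of \<open>f\<close> yields the reverse of the arithmetic
    inequality.\<close>
  have "((?q - k) * (?q - s') * ?q ^ t) * ?q ^ ?n \<le> (?q * (?q - s) * ?q ^ t') * ?q ^ ?n"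
    unfolding 2[symmetric] 3[symmetric] using 1 by (rule mult_le_mono1)
  then have "(?q - k) * (?q - s') * ?q ^ t \<le> ?q * (?q - s) * ?q ^ t'" by simp
  with ar(3) have eq: "?q * (?q - s) * ?q ^ t' = (?q - k) * (?q - s') * ?q ^ t" by (rule antisym)
  have "(?q * weight f) * ?q ^ (t' + 1) * ?q ^ t = (?q - k) * ((?q - s') * ?q ^ ?n) * ?q ^ t"
    unfolding 2 3 eq ..
  then have 4: "(?q * weight f) * ?q ^ (t' + 1) = (?q - k) * ((?q - s') * ?q ^ ?n)" by simp
  have min: "minimal_word t' s' (cylinder f a u w)" if w: "w \<notin> missed f a" for w
  proof -
    have "weight (cylinder f a u w) * ?q ^ (t' + 1) = (?q - s') * ?q ^ ?n"
    proof (rule sum_weights_eq[of "- missed f a"])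
      show "(\<Sum>w\<in>- missed f a. weight (cylinder f a u w)) * ?q ^ (t' + 1)
          \<le> card (- missed f a) * ((?q - s') * ?q ^ ?n)"
        unfolding card weight_eq_sum_cylinders[OF u, symmetric] 4 ..
    qed (use cb w in auto)
    then show ?thesis using cR[OF w] ar(1) by (simp add: minimal_word_def)
  qed
  from ar(4)[OF eq] consider "k = 0" | "k = s" | "k = ?q - 1" "s < k" "t \<ge> 1" by blast
  then show ?thesis
  proof cases
    case 1
    then have "missed f a = {}" by (simp add: k_def)
    then show ?thesis using min 1 by (simp add: t'_def s'_def)
  next
    case 2
    then show ?thesis using min by (simp add: t'_def s'_def)
  next
    case 3
    then have "t' = t - 1" "s' = s" by (auto simp: t'_def s'_def)
    then show ?thesis using min 3 by simp
  qed
qed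

section \<open>Hyperplane sections of minimal supports\<close>

lemma card_hyperplane:
  fixes a :: "'a::{finite,field}^'m"
  assumes "a \<noteq> 0"
  shows "CARD('a) * card (hyperplane a w) = CARD('a) ^ CARD('m)"
proof -
  obtain u where u: "dot a u = 1" using ex_dot_eq_1[OF assms] .
  have "supp (\<lambda>x :: 'a^'m. 1 :: 'a) = UNIV" by (simp add: supp_def)
  \<comment> \<open>The constant 1 is its own cylinder, and its slice is the whole
    hyperplane.\<close>
  moreover have "cylinder (\<lambda>x :: 'a^'m. 1 :: 'a) a u w = (\<lambda>x. 1)" by (simp add: cylinder_def fun_eq_iff)
  ultimately show ?thesis using weight_cylinder[OF u, of "\<lambda>x. 1" w] by (simp add: weight_def)
qed

text \<open>Double counting of the pairs of a form \<open>a\<close> and a point \<open>y \<in> S\<close> with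
  \<open>a y = a x\<close>: the count depends on whether \<open>x \<in> S\<close>, but would not if all hyperplanes met
  \<open>S\<close> equally often.\<close>

lemma equidistributed_on_hyperplanes:
  fixes S :: "('a::{finite,field}^'m) set"
  assumes eq: "\<And>a w. a \<noteq> 0 \<Longrightarrow> CARD('a) * card (S \<inter> hyperplane a w) = card S"
    and "S \<noteq> {}"
  shows "S = UNIV"
proof (rule ccontr)
  assume "S \<noteq> UNIV"
  then obtain x0 where x0: "x0 \<notin> S" by blast
  from \<open>S \<noteq> {}\<close> obtain x1 where x1: "x1 \<in> S" by blast
  let ?q = "CARD('a)" and ?n = "CARD('m)"
  define N where "N x = ?q * (\<Sum>a\<in>UNIV. card (S \<inter> hyperplane a (dot a x)))" for x :: "'a^'m"
  have N1: "N x = (\<Sum>a\<in>(UNIV :: ('a^'m) set). if a = 0 then ?q * card S else card S)" for x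
    unfolding N_def sum_distrib_left
    by (rule sum.cong) (auto simp: eq, simp add: hyperplane_def)
  have N2: "N x = (\<Sum>y\<in>S. if y = x then ?q * ?q ^ ?n else ?q ^ ?n)" for x
  proof -
    have "(\<Sum>a\<in>(UNIV :: ('a^'m) set). card (S \<inter> hyperplane a (dot a x)))
        = (\<Sum>a\<in>UNIV. \<Sum>y\<in>S. if dot a y = dot a x then 1 else 0)"
      by (rule sum.cong) (simp_all add: hyperplane_def sum.If_cases)
    also have "\<dots> = (\<Sum>y\<in>S. \<Sum>a\<in>UNIV. if dot a y = dot a x then 1 else 0)"
      by (rule sum.swap)
    also have "\<dots> = (\<Sum>y\<in>S. card (hyperplane (y - x) 0))"
    proof (rule sum.cong)
      fix y
      \<comment> \<open>Dually, the forms agreeing at \<open>x\<close> and \<open>y\<close> make up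
        a hyperplane, or the whole space if \<open>y = x\<close>.\<close>
      have "hyperplane (y - x) 0 = {a. dot a y = dot a x}"
        unfolding hyperplane_def dot_commute[of "y - x"] by simp
      then show "(\<Sum>a\<in>UNIV. if dot a y = dot a x then 1 else 0) = card (hyperplane (y - x) 0)"
        by (simp add: sum.If_cases)
    qed simp
    finally have "N x = (\<Sum>y\<in>S. ?q * card (hyperplane (y - x) 0))"
      by (simp add: N_def sum_distrib_left)
    also have "\<dots> = (\<Sum>y\<in>S. if y = x then ?q * ?q ^ ?n else ?q ^ ?n)"
      by (rule sum.cong) (auto simp: card_hyperplane, simp add: hyperplane_def)
    finally show ?thesis .
  qed
  have "N x0 = (\<Sum>y\<in>S. ?q ^ ?n)" unfolding N2 using x0 by (intro sum.cong) auto
  moreover have "(\<Sum>y\<in>S. ?q ^ ?n) < N x1" unfolding N2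
    using x1 card_field_ge_2[where 'a='a] by (intro sum_strict_mono_ex1) auto
  ultimately show False using N1[of x0] N1[of x1] by simp
qed

text \<open>Otherwise every cylinder is minimal for the same \<open>t\<close> and \<open>s\<close>,
  so all hyperplanes meet the support equally often and it is the whole space.\<close>

lemma minimal_word_misses_hyperplane:
  fixes f :: "'a::{finite,field}^'m \<Rightarrow> 'a"
  assumes f: "minimal_word t s f" and ne: "supp f \<noteq> UNIV"
  obtains a where "a \<noteq> 0" "missed f a \<noteq> {}"
proof (rule ccontr)
  assume "\<not> thesis"
  with that have none: "missed f a = {}" if "a \<noteq> 0" for a using \<open>a \<noteq> 0\<close> by blast
  have "CARD('a) * card (supp f \<inter> hyperplane a w) = card (supp f)" if a: "a \<noteq> 0" for a w
  proof -
    obtain u where u: "dot a u = 1" using ex_dot_eq_1[OF a] .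
    have "minimal_word t s (cylinder f a u w)"
      using minimal_word_cylinders[OF f u] none[OF a] card_field_ge_2[where 'a='a] by auto
    then have "weight (cylinder f a u w) * CARD('a) ^ (t + 1) = weight f * CARD('a) ^ (t + 1)"
      using f by (simp add: minimal_word_def)
    then have "weight (cylinder f a u w) = weight f" by simp
    then show ?thesis using weight_cylinder[OF u, of f w] by (simp add: weight_def)
  qed
  moreover have "supp f \<noteq> {}" using minimal_word_nonzero[OF f] by (auto simp: supp_def)
  ultimately show False using equidistributed_on_hyperplanes ne by blast
qed

lemma supp_eq_UNIV_iff:
  fixes f :: "'a::{finite,field}^'m \<Rightarrow> 'a"
  assumes "minimal_word t s f"
  shows "supp f = UNIV \<longleftrightarrow> t = 0 \<and> s = 0"
proof -
  let ?q = "CARD('a)" and ?n = "CARD('m)"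
  have q: "?q \<ge> 2" by (rule card_field_ge_2)
  have wf: "card (supp f) * ?q ^ (t + 1) = (?q - s) * ?q ^ ?n" and s: "s \<le> ?q - 2"
    using assms by (auto simp: minimal_word_def weight_def)
  have "supp f = UNIV \<longleftrightarrow> card (supp f) = ?q ^ ?n"
    using card_subset_eq[of UNIV "supp f"] by auto
  also have "\<dots> \<longleftrightarrow> card (supp f) * ?q ^ (t + 1) = ?q ^ ?n * ?q ^ (t + 1)"
    by simp
  also have "\<dots> \<longleftrightarrow> ?q - s = ?q * ?q ^ t" unfolding wf by (simp add: mult.commute)
  also have "\<dots> \<longleftrightarrow> t = 0 \<and> s = 0"
  proof
    assume eq: "?q - s = ?q * ?q ^ t"
    have "t = 0"
    proof (rule ccontr)
      assume "t \<noteq> 0"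
      then have "?q * 2 \<le> ?q * ?q ^ t"
        using q self_le_power[of ?q t] by (intro mult_le_mono2) linarith
      then show False using eq q by linarith
    qed
    then show "t = 0 \<and> s = 0" using eq s q by simp
  qed simp
  finally show ?thesis .
qed

lemma supp_subset_hyperplane:
  fixes f :: "'a::{finite,field}^'m \<Rightarrow> 'a"
  assumes "card (missed f a) = CARD('a) - 1"
  obtains w where "supp f \<subseteq> hyperplane a w"
proof -
  have "card (- missed f a) = 1"
    using assms card_field_ge_2[where 'a='a] by (simp add: Compl_eq_Diff_UNIV card_Diff_subset)
  then obtain w where w: "- missed f a = {w}" by (rule card_1_singletonE)
  have "dot a x = w" if "x \<in> supp f" for x
  proof -
    have "dot a x \<in> - missed f a" using that by (auto simp: missed_def hyperplane_def)
    then show ?thesis using w by simp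
  qed
  then show thesis by (intro that[of w]) (auto simp: hyperplane_def)
qed

text \<open>For \<open>s = 0\<close> a nonempty missed set leaves only the alternative q - 1. The
  general case applies this to slices with remainder 0.\<close>

lemma minimal_word_0_in_hyperplane:
  fixes f :: "'a::{finite,field}^'m \<Rightarrow> 'a"
  assumes f: "minimal_word t 0 f" and t: "t \<ge> 1"
  obtains a w where "a \<noteq> 0" "supp f \<subseteq> hyperplane a w"
proof -
  obtain a where a: "a \<noteq> 0" "missed f a \<noteq> {}"
    using minimal_word_misses_hyperplane[OF f] supp_eq_UNIV_iff[OF f] t by auto
  obtain u where u: "dot a u = 1" using ex_dot_eq_1[OF a(1)] .
  have "card (missed f a) = CARD('a) - 1"
    using minimal_word_cylinders[OF f u] a(2) by auto
  then show thesis using supp_subset_hyperplane that a(1) by blast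
qed

text \<open>If exactly \<open>s\<close> parallel hyperplanes are missed, each remaining slice lies in a subspace of
  codimension at least two, so a pencil argument yields a hyperplane through one slice and
  a further point of the support; it meets the support too often not to contain it.\<close>

lemma minimal_word_in_hyperplane:
  fixes f :: "'a::{finite,field}^'m \<Rightarrow> 'a"
  assumes f: "minimal_word t s f" and t: "t \<ge> 1"
  obtains a w where "a \<noteq> 0" "supp f \<subseteq> hyperplane a w"
proof -
  let ?q = "CARD('a)" and ?n = "CARD('m)"
  have q: "?q \<ge> 2" by (rule card_field_ge_2)
  have s: "s \<le> ?q - 2" using f by (simp add: minimal_word_def)
  obtain a where a: "a \<noteq> 0" "missed f a \<noteq> {}"
    using minimal_word_misses_hyperplane[OF f] supp_eq_UNIV_iff[OF f] t by auto
  obtain u where u: "dot a u = 1" using ex_dot_eq_1[OF a(1)] .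
  show thesis
  proof (cases "card (missed f a) = ?q - 1")
    case True
    then show thesis using supp_subset_hyperplane that a(1) by blast
  next
    case False
    then have k: "card (missed f a) = s"
      and min: "\<And>w. w \<notin> missed f a \<Longrightarrow> minimal_word t 0 (cylinder f a u w)"
      using minimal_word_cylinders[OF f u] a(2) by auto
    have "card (- missed f a) \<ge> 2"
      using k s q by (simp add: Compl_eq_Diff_UNIV card_Diff_subset)
    then obtain D where "D \<subseteq> - missed f a" "card D = 2" by (metis obtain_subset_with_card_n)
    then obtain w w' where w: "w \<notin> missed f a" "w' \<notin> missed f a" "w \<noteq> w'"
      by (auto simp: card_2_iff)
    from w(2) obtain y where y: "y \<in> supp f" "dot a y = w'"
      by (auto simp: missed_def hyperplane_def)
    from w(1) obtain x0 where x0: "x0 \<in> supp f" "x0 \<in> hyperplane a w"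
      by (auto simp: missed_def)
    obtain a1 b1 where a1: "a1 \<noteq> 0" "supp (cylinder f a u w) \<subseteq> hyperplane a1 b1"
      using minimal_word_0_in_hyperplane[OF min[OF w(1)] t] .
    have x0c: "x0 \<in> supp (cylinder f a u w)"
      using x0 by (simp add: supp_def cylinder_eq_on_hyperplane)
    \<comment> \<open>The support of the cylinder is a union of lines in direction \<open>u\<close>,
      so the hyperplane containing it is parallel to \<open>u\<close>.\<close>
    then have "x0 + 1 *s u \<in> supp (cylinder f a u w)" by (rule supp_cylinder_translate[OF u])
    with x0c have "x0 + 1 *s u \<in> hyperplane a1 b1" "x0 \<in> hyperplane a1 b1" using a1(2) by auto
    then have a1u: "dot a1 u = 0" by (simp add: hyperplane_def)
    \<comment> \<open>The member through \<open>y\<close> of the pencil spanned by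
      \<open>dot a x = w\<close> and \<open>dot a1 x = b1\<close>. Evaluating at \<open>u\<close>,
      where \<open>a1\<close> vanishes, isolates the coefficient of \<open>a\<close>.\<close>
    define a' where "a' = (dot a1 y - b1) *s a - (dot a y - w) *s a1"
    define \<beta> where "\<beta> = dot a' y"
    have "a' \<noteq> 0"
    proof
      assume 0: "a' = 0"
      then have "dot a' u = 0" by simp
      then have "dot a1 y - b1 = 0" by (simp add: a'_def u a1u)
      then have "(dot a y - w) *s a1 = 0" using 0 by (simp add: a'_def)
      then show False using a1 y w by simp
    qed
    then obtain u' where u': "dot a' u' = 1" using ex_dot_eq_1 by blast
    have sub: "insert y (supp f \<inter> hyperplane a w) \<subseteq> supp f \<inter> hyperplane a' \<beta>"
    proof -
      have "dot a' x = \<beta>" if x: "x \<in> supp f" "dot a x = w" for x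
      proof -
        have "x \<in> supp (cylinder f a u w)"
          using x by (simp add: supp_def cylinder_eq_on_hyperplane hyperplane_def)
        then have "dot a1 x = b1" using a1 by (auto simp: hyperplane_def)
        then show ?thesis by (simp add: \<beta>_def a'_def x algebra_simps)
      qed
      then show ?thesis using y by (auto simp: hyperplane_def \<beta>_def)
    qed
    have \<beta>: "\<beta> \<notin> missed f a'" using y by (auto simp: missed_def hyperplane_def \<beta>_def)
    have "card (supp f \<inter> hyperplane a w) < card (insert y (supp f \<inter> hyperplane a w))"
      using y w by (subst card_insert_disjoint) (auto simp: hyperplane_def)
    also have "\<dots> \<le> card (supp f \<inter> hyperplane a' \<beta>)" by (rule card_mono[OF _ sub]) simp
    finally have "weight (cylinder f a u w) < weight (cylinder f a' u' \<beta>)"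
      by (simp add: weight_cylinder u u')
    then have "weight (cylinder f a u w) * ?q ^ (t + 1) < weight (cylinder f a' u' \<beta>) * ?q ^ (t + 1)"
      by simp
    moreover have "weight (cylinder f a u w) * ?q ^ (t + 1) = (?q - 0) * ?q ^ ?n"
      using min[OF w(1)] unfolding minimal_word_def by blast
    ultimately have gt: "?q * ?q ^ ?n < weight (cylinder f a' u' \<beta>) * ?q ^ (t + 1)"
      by (simp only: diff_zero)
    \<comment> \<open>The cylinder outweighs every minimal word with the same \<open>t\<close>,
      which excludes the first two alternatives for \<open>a'\<close>.\<close>
    have "\<not> minimal_word t s' (cylinder f a' u' \<beta>)" for s'
    proof
      assume "minimal_word t s' (cylinder f a' u' \<beta>)"
      then have "weight (cylinder f a' u' \<beta>) * ?q ^ (t + 1) = (?q - s') * ?q ^ ?n"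
        by (simp add: minimal_word_def)
      also have "\<dots> \<le> ?q * ?q ^ ?n" by (rule mult_le_mono1) simp
      finally show False using gt by simp
    qed
    then have "card (missed f a') = ?q - 1"
      using minimal_word_cylinders[OF f u'] \<beta> by blast
    then show thesis using supp_subset_hyperplane that \<open>a' \<noteq> 0\<close> by blast
  qed
qed

section \<open>Subspaces and slabs\<close>

lemma dim_Int_hyperplane:
  fixes U :: "('a::{finite,field}^'m) set"
  assumes U: "vec.subspace U" and u: "u \<in> U" "dot a u = 1"
  shows "vec.subspace (U \<inter> hyperplane a 0)"
    and "vec.dim U = vec.dim (U \<inter> hyperplane a 0) + 1"
proof -
  let ?V = "U \<inter> hyperplane a 0"
  show V: "vec.subspace ?V"
    using U by (auto simp: vec.subspace_def hyperplane_def)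
  have sp: "vec.span ?V = ?V" using V by (simp add: vec.span_eq_iff)
  have "U \<subseteq> vec.span (insert u ?V)"
  proof
    fix x assume "x \<in> U"
    then have "x - dot a x *s u \<in> ?V"
      using U u by (auto simp: hyperplane_def vec.subspace_diff vec.subspace_scale)
    then show "x \<in> vec.span (insert u ?V)"
      unfolding vec.span_insert sp by blast
  qed
  moreover have "vec.span (insert u ?V) \<subseteq> U"
    by (rule vec.span_minimal) (use U u in auto)
  ultimately have "vec.dim U = vec.dim (insert u ?V)"
    by (metis equalityI vec.dim_span)
  also have "\<dots> = vec.dim ?V + 1"
    using u by (simp add: vec.dim_insert sp) (simp add: hyperplane_def)
  finally show "vec.dim U = vec.dim ?V + 1" .
qed

text \<open>Induction on the dimension: the indicator of \<open>V\<close> is its own cylinder along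
  any \<open>v \<in> V\<close>, so \<open>weight_cylinder\<close> compares \<open>V\<close> with its
  section by a hyperplane transversal to \<open>v\<close>.\<close>

lemma card_subspace:
  fixes V :: "('a::{finite,field}^'m) set"
  assumes "vec.subspace V"
  shows "card V = CARD('a) ^ vec.dim V"
  using assms
proof (induction "vec.dim V" arbitrary: V)
  case 0
  then have "V = {0}" using vec.dim_eq_0[of V] vec.subspace_0 by fastforce
  then show ?case using 0 by simp
next
  case (Suc d)
  then obtain v where v: "v \<in> V" "v \<noteq> 0"
    by (metis nat.distinct(1) singletonI subsetI vec.dim_eq_0)
  then obtain a where a: "dot a v = 1" using ex_dot_eq_1 dot_commute by metis
  define f :: "'a^'m \<Rightarrow> 'a" where "f x = (if x \<in> V then 1 else 0)" for x
  have "x + z *s v \<in> V \<longleftrightarrow> x \<in> V" for x z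
    using vec.subspace_scale[OF Suc.prems v(1)] vec.subspace_add[OF Suc.prems]
      vec.subspace_diff[OF Suc.prems] by (metis add_diff_cancel_right')
  then have "cylinder f a v 0 = f" by (simp only: cylinder_def f_def fun_eq_iff simp_thms)
  moreover have "supp f = V" by (auto simp: supp_def f_def)
  ultimately have "card V = CARD('a) * card (V \<inter> hyperplane a 0)"
    using weight_cylinder[OF a, of f 0] by (simp add: weight_def)
  moreover have "card (V \<inter> hyperplane a 0) = CARD('a) ^ vec.dim (V \<inter> hyperplane a 0)"
    using dim_Int_hyperplane[OF Suc.prems v(1) a] Suc.hyps by auto
  ultimately show ?case using dim_Int_hyperplane[OF Suc.prems v(1) a] by simp
qed

text \<open>The form \<open>l\<close> is non-constant on \<open>b + U\<close>, and its fibres over \<open>C\<close> are the parallel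
  subspaces.\<close>

definition slab :: "nat \<Rightarrow> nat \<Rightarrow> ('a::{finite,field}^'m) set \<Rightarrow> bool" where
  "slab t s S \<longleftrightarrow> (\<exists>b U l v C. vec.subspace U \<and> vec.dim U = CARD('m) - t \<and> v \<in> U \<and>
     dot l v = 1 \<and> card C = CARD('a) - s \<and> S = {x. x - b \<in> U \<and> dot l x \<in> C})"

lemma slabI:
  fixes S :: "('a::{finite,field}^'m) set"
  assumes "vec.subspace U" "vec.dim U = CARD('m) - t" "v \<in> U" "dot l v = 1"
    "card C = CARD('a) - s" "S = {x. x - b \<in> U \<and> dot l x \<in> C}"
  shows "slab t s S"
  unfolding slab_def using assms by blast

lemma supp_minimal_word_slab:
  fixes f :: "'a::{finite,field}^'m \<Rightarrow> 'a"
  assumes "minimal_word t s f" "t < CARD('m)"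
  shows "slab t s (supp f)"
  using assms
proof (induction t arbitrary: s f)
  case 0
  note f = 0(1)
  have dimU: "vec.dim (UNIV :: ('a^'m) set) = CARD('m)" by (rule vec_dim_card)
  show ?case
  proof (cases "s = 0")
    case True
    then have "supp f = UNIV" using supp_eq_UNIV_iff[OF f] by simp
    \<comment> \<open>With all values allowed any nonconstant form serves; an arbitrary coordinate
      is taken.\<close>
    then show ?thesis using True dimU
      by (intro slabI[of UNIV 0 "axis undefined 1" "axis undefined 1" UNIV s "supp f" 0])
        auto
  next
    case False
    then obtain a where a: "a \<noteq> 0" "missed f a \<noteq> {}"
      using minimal_word_misses_hyperplane[OF f] supp_eq_UNIV_iff[OF f] by auto
    obtain u where u: "dot a u = 1" using ex_dot_eq_1[OF a(1)] .
    \<comment> \<open>A nonempty missed set and \<open>t = 0\<close> leave only the alternative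
      \<open>s\<close>. Its slices have cylinders with full support, so they are entire
      hyperplanes.\<close>
    from minimal_word_cylinders[OF f u] a(2) have k: "card (missed f a) = s"
      and min: "\<And>w. w \<notin> missed f a \<Longrightarrow> minimal_word 0 0 (cylinder f a u w)" by auto
    have "x \<in> supp f \<longleftrightarrow> dot a x \<in> - missed f a" for x
    proof
      assume "dot a x \<in> - missed f a"
      then have "supp (cylinder f a u (dot a x)) = UNIV"
        using min supp_eq_UNIV_iff[of 0 0] by auto
      moreover have "cylinder f a u (dot a x) x = f x" by (simp add: cylinder_def)
      ultimately show "x \<in> supp f" by (auto simp: supp_def)
    qed (auto simp: missed_def hyperplane_def)
    moreover have "card (- missed f a) = CARD('a) - s"
      using k by (simp add: Compl_eq_Diff_UNIV card_Diff_subset)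
    ultimately show ?thesis using u dimU
      by (intro slabI[of UNIV 0 u a "- missed f a" s "supp f" 0]) auto
  qed
next
  case (Suc t)
  note f = Suc.prems(1)
  have q: "CARD('a) \<ge> 2" by (rule card_field_ge_2)
  have s: "s \<le> CARD('a) - 2" using f by (simp add: minimal_word_def)
  obtain a w where a: "a \<noteq> 0" and sub: "supp f \<subseteq> hyperplane a w"
    using minimal_word_in_hyperplane[OF f] by auto
  obtain u where u: "dot a u = 1" using ex_dot_eq_1[OF a] .
  obtain x0 where x0: "x0 \<in> supp f" using minimal_word_nonzero[OF f] by (auto simp: supp_def)
  have x0w: "dot a x0 = w" using x0 sub by (auto simp: hyperplane_def)
  have "missed f a = UNIV - {w}" using x0 sub by (auto simp: missed_def hyperplane_def)
  then have w: "w \<notin> missed f a" and k: "card (missed f a) = CARD('a) - 1"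
    by (auto simp: card_Diff_singleton)
  \<comment> \<open>Since q - 1 is neither 0 nor \<open>s\<close>, the third alternative
    applies.\<close>
  then have "minimal_word t s (cylinder f a u w)"
    using minimal_word_cylinders[OF f u] s q by auto
  then have "slab t s (supp (cylinder f a u w))" using Suc by simp
  then obtain b U l v C where U: "vec.subspace U" "vec.dim U = CARD('m) - t"
    and v: "v \<in> U" "dot l v = 1" and C: "card C = CARD('a) - s"
    and S: "supp (cylinder f a u w) = {x. x - b \<in> U \<and> dot l x \<in> C}"
    unfolding slab_def by blast
  have Sf: "x \<in> supp f \<longleftrightarrow> x \<in> supp (cylinder f a u w) \<and> dot a x = w" for x
    using sub by (auto simp: hyperplane_def supp_def cylinder_def)
  have line: "x0 + z *s u \<in> supp (cylinder f a u w)" for z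
    using supp_cylinder_translate[OF u] x0 Sf by blast
  have x0b: "x0 - b \<in> U" using x0 Sf S by auto
  \<comment> \<open>Recentring at a point of the support merges membership in the slab and in the
    hyperplane into one subspace condition.\<close>
  have shift: "x - b \<in> U \<longleftrightarrow> x - x0 \<in> U" for x
    using vec.subspace_add[OF U(1) _ x0b, of "x - x0"] vec.subspace_diff[OF U(1) _ x0b, of "x - b"]
    by auto
  have uU: "u \<in> U" using line[of 1] unfolding S shift by simp
  let ?U = "U \<inter> hyperplane a 0"
  have V: "vec.subspace ?U" "vec.dim ?U = CARD('m) - Suc t"
    using dim_Int_hyperplane[OF U(1) uU u] U(2) by auto
  have supp: "supp f = {x. x - x0 \<in> ?U \<and> dot l x \<in> C}"
    using Sf S shift x0w by (auto simp: hyperplane_def)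
  show ?case
  proof (cases "s = 0")
    case True
    then have "C = UNIV" using C card_subset_eq[of UNIV C] by simp
    \<comment> \<open>The old \<open>l\<close> may be constant on \<open>?U\<close>. As
      \<open>C\<close> is everything, any form that is nonconstant there can replace it.\<close>
    have "vec.dim ?U \<noteq> 0" using V(2) Suc.prems(2) by simp
    then obtain v' where v': "v' \<in> ?U" "v' \<noteq> 0" by (metis singletonI subsetI vec.dim_eq_0)
    then obtain l' where "dot l' v' = 1" using ex_dot_eq_1 dot_commute by metis
    then show ?thesis using V v' C supp \<open>C = UNIV\<close>
      by (intro slabI[of ?U "Suc t" v' l' C s "supp f" x0]) auto
  next
    case False
    \<comment> \<open>Otherwise \<open>l\<close> takes every value on the line through
      \<open>x0\<close>, although \<open>C\<close> is proper. Hence projecting \<open>v\<close>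
      along \<open>u\<close> into \<open>?U\<close> keeps the value of \<open>l\<close>.\<close>
    have "dot l u = 0"
    proof (rule ccontr)
      assume l: "dot l u \<noteq> 0"
      have "c \<in> C" for c
        using line[of "(c - dot l x0) / dot l u"] l unfolding S by simp
      then have "C = UNIV" by auto
      then show False using C False s q by simp
    qed
    then have "dot l (v - dot a v *s u) = 1" using v by simp
    moreover have "v - dot a v *s u \<in> ?U"
      using U(1) v uU u by (auto simp: hyperplane_def vec.subspace_diff vec.subspace_scale)
    ultimately show ?thesis using V C supp
      by (intro slabI[of ?U "Suc t" "v - dot a v *s u" l C s "supp f" x0])
  qed
qed

section \<open>The characterization of minimal supports\<close>

lemma mem_coset_iff: "x \<in> (\<lambda>y. a + y) ` V \<longleftrightarrow> x - a \<in> V" for x a :: "'b::ab_group_add"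
  by (auto simp: image_iff intro: bexI[of _ "x - a"])

theorem theorem1:
  fixes f :: "'a::{finite,field}^'m \<Rightarrow> 'a"
    and r t s :: nat
  assumes "s \<le> CARD('a) - 2"
    and "r = t * (CARD('a) - 1) + s"
    and "r < CARD('m) * (CARD('a) - 1)"
    and "f \<in> RM r"
    and "f \<noteq> (\<lambda>x. 0)"
  shows "weight f = (CARD('a) - s) * CARD('a) ^ (CARD('m) - t - 1) \<longleftrightarrow>
    (\<exists>A :: nat \<Rightarrow> ('a^'m) set. \<exists>V.
        (\<forall>i < CARD('a) - s. affine_with_dir (A i) V \<and> affine_codim (t + 1) (A i))
      \<and> inj_on A {..< CARD('a) - s}
      \<and> supp f = (\<Union>i < CARD('a) - s. A i)
      \<and> (\<exists>B. affine_codim t B \<and> supp f \<subseteq> B))"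
    (is "?weight \<longleftrightarrow> ?union")
proof
  have "t * (CARD('a) - 1) < CARD('m) * (CARD('a) - 1)" using assms(2,3) by linarith
  then have t: "t < CARD('m)" by simp
  {
    assume ?weight
    have "weight f * CARD('a) ^ (t + 1) = (CARD('a) - s) * CARD('a) ^ (CARD('m) - t - 1 + (t + 1))"
      unfolding \<open>?weight\<close> power_add by (simp only: mult.assoc)
    also have "CARD('m) - t - 1 + (t + 1) = CARD('m)" using t by simp
    finally have "minimal_word t s f" using assms by (simp add: minimal_word_def)
    then have "slab t s (supp f)" using t by (rule supp_minimal_word_slab)
    then obtain b U l v C where U: "vec.subspace U" "vec.dim U = CARD('m) - t"
      and v: "v \<in> U" "dot l v = 1" and C: "card C = CARD('a) - s"
      and S: "supp f = {x. x - b \<in> U \<and> dot l x \<in> C}"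
      unfolding slab_def by blast
    obtain c where c: "bij_betw c {..<CARD('a) - s} C"
      using ex_bij_betw_nat_finite[of C] C by (auto simp: lessThan_atLeast0)
    \<comment> \<open>The parallel subspaces are the level sets of \<open>l\<close> on
      \<open>b + U\<close>: \<open>V\<close> is their common direction, and \<open>p i\<close> is
      \<open>b\<close> moved along \<open>v\<close> to the level \<open>c i\<close>.\<close>
    define V where "V = U \<inter> hyperplane l 0"
    define p where "p i = b + (c i - dot l b) *s v" for i
    define A where "A i = (\<lambda>y. p i + y) ` V" for i
    have V: "vec.subspace V" "vec.dim V = CARD('m) - (t + 1)"
      using dim_Int_hyperplane[OF U(1) v] U(2) by (auto simp: V_def)
    have A: "A i = {x. x - b \<in> U \<and> dot l x = c i}" for i
    proof -
      have pU: "p i - b \<in> U" using v U(1) by (simp add: p_def vec.subspace_scale)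
      have pl: "dot l (p i) = c i" using v by (simp add: p_def)
      have "x - p i \<in> V \<longleftrightarrow> x - b \<in> U \<and> dot l x = c i" for x
        using vec.subspace_add[OF U(1) _ pU, of "x - p i"] vec.subspace_diff[OF U(1) _ pU, of "x - b"] pl
        by (auto simp: V_def hyperplane_def)
      moreover have "x \<in> A i \<longleftrightarrow> x - p i \<in> V" for x
        unfolding A_def by (rule mem_coset_iff)
      ultimately show ?thesis by auto
    qed
    have dir: "affine_with_dir (A i) V" for i
      using V by (auto simp: affine_with_dir_def A_def)
    have "affine_codim (t + 1) (A i)" for i
      using dir V t unfolding affine_codim_def by auto
    moreover have "inj_on A {..<CARD('a) - s}"
    proof (rule inj_onI)
      fix i j assume ij: "i \<in> {..<CARD('a) - s}" "j \<in> {..<CARD('a) - s}" "A i = A j"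
      have "p i \<in> A i" using V by (auto simp: A_def vec.subspace_0 image_iff intro!: bexI[of _ 0])
      then have "p i \<in> A i" "p i \<in> A j" using ij(3) by auto
      then have "c i = c j" unfolding A by simp
      then show "i = j" using c ij by (auto simp: bij_betw_def inj_on_def)
    qed
    moreover have "supp f = (\<Union>i < CARD('a) - s. A i)"
      using c unfolding A S bij_betw_def by auto
    moreover have "affine_codim t ((\<lambda>y. b + y) ` U)"
      using U t unfolding affine_codim_def affine_with_dir_def by auto
    moreover have "supp f \<subseteq> (\<lambda>y. b + y) ` U" by (auto simp: S mem_coset_iff)
    ultimately show ?union using dir by blast
  }
  {
    assume ?union
    \<comment> \<open>The converse is a count: distinct cosets of one direction are disjoint, and
      the codimension fixes their size.\<close>
    then obtain A V
      where AV: "\<forall>i < CARD('a) - s. affine_with_dir (A i) V \<and> affine_codim (t + 1) (A i)"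
      and inj: "inj_on A {..<CARD('a) - s}" and S: "supp f = (\<Union>i < CARD('a) - s. A i)"
      by (elim exE conjE) (rule that)
    from AV have A: "\<And>i. i < CARD('a) - s \<Longrightarrow> affine_with_dir (A i) V"
      "\<And>i. i < CARD('a) - s \<Longrightarrow> affine_codim (t + 1) (A i)" by auto
    have card: "card (A i) = CARD('a) ^ (CARD('m) - t - 1)" if i: "i < CARD('a) - s" for i
    proof -
      obtain V' a where "vec.subspace V'" "A i = (\<lambda>y. a + y) ` V'" "vec.dim V' = CARD('m) - (t + 1)"
        using A(2)[OF i] unfolding affine_codim_def affine_with_dir_def by blast
      then show ?thesis by (simp add: card_image card_subspace)
    qed
    have disj: "A i \<inter> A j = {}"
      if ij: "i < CARD('a) - s" "j < CARD('a) - s" "i \<noteq> j" for i j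
    proof (rule ccontr)
      assume "A i \<inter> A j \<noteq> {}"
      then obtain x where x: "x \<in> A i" "x \<in> A j" by blast
      have coset: "A k = {y. y - x \<in> V}" if k: "k < CARD('a) - s" "x \<in> A k" for k
      proof -
        obtain a where V: "vec.subspace V" and a: "A k = (\<lambda>y. a + y) ` V"
          using A(1)[OF k(1)] unfolding affine_with_dir_def by blast
        have mem: "y \<in> A k \<longleftrightarrow> y - a \<in> V" for y
          unfolding a by (rule mem_coset_iff)
        have xa: "x - a \<in> V" using k(2) mem by simp
        have "y - a \<in> V \<longleftrightarrow> y - x \<in> V" for y
          using vec.subspace_add[OF V _ xa, of "y - x"] vec.subspace_diff[OF V _ xa, of "y - a"]
          by auto
        then show ?thesis using mem by auto
      qed
      have "A i = A j" using coset[OF ij(1) x(1)] coset[OF ij(2) x(2)] by (simp only:)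
      then show False using inj ij by (auto simp: inj_on_def)
    qed
    have "weight f = (\<Sum>i<CARD('a) - s. card (A i))"
      unfolding weight_def S by (rule card_UN_disjoint) (use disj in auto)
    then show ?weight by (simp add: card)
  }
qed

end
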